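(* Let $F=\{f_n\}_{n\in\mathbb N}$ be a time varying uniform equivalence on a separable metric space $(X,d)$ such that the family $\{f_n,f_n^{-1}\}_{n\in\mathbb N}$ is equicontinuous. Then $F$ is aperiodic with respect to every outer regular non-atomic Borel measure on $X$ that is expansive with respect to $F$.
   Context: $\mathbb N$ denotes the non-negative integers. A uniform equivalence is a homeomorphism $h:X\to X$ such that $h$ and $h^{-1}$ are uniformly continuous. A time varying uniform equivalence is a family $F=\{f_n\}_{n\in\mathbb N}$ of uniform equivalences $f_n:X\to X$ with $f_0=\mathrm{id}_X$. Put $F_n=f_n\circ\cdots\circ f_1\circ f_0$ for $n\ge 0$ and $F_n=f_{-n}^{-1}\circ f_{-(n-1)}^{-1}\circ\cdots\circ f_1^{-1}\circ f_0^{-1}$ for $n<0$. A family $\mathcal F$ of functions is equicontinuous if for every $\epsilon>0$ there is $\delta>0$ such that $d(x,y)<\delta$ implies $d(f(x),f(y))<\epsilon$ for all $f\in\mathcal F$. A Borel measure $\mu$ is non-atomic if $\mu(\{x\})=0$ for all $x$. A non-atomic Borel measure $\mu$ is expansive with respect to $F$ if there is $\delta>0$ such that $\mu(\Gamma_\delta(x))=0$ for all $x\in X$, where $\Gamma_\delta(x)=\{y\in X: d(F_n(x),F_n(y))\le\delta\text{ for all }n\in\mathbb Z\}$. A point $p\in X$ is periodic with period $k$ (an integer $k>0$) if $F_{ik+j}(p)=F_j(p)$ for all $i\in\mathbb Z$ and $0\le j<k$. A set $A\subset X$ is periodic if there is $k>0$ such that each point of $A$ is periodic with period $k$. $F$ is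 aperiodic with respect to $\mu$ if every measurable periodic subset of $X$ has $\mu$-measure zero. *)

theory Defs
  imports "HOL-Analysis.Analysis"
begin

definition uniform_equivalence :: "('a::metric_space \<Rightarrow> 'a) \<Rightarrow> bool" where
  "uniform_equivalence h \<longleftrightarrow>
     homeomorphism UNIV UNIV h (inv h) \<and>
     uniformly_continuous_on UNIV h \<and> uniformly_continuous_on UNIV (inv h)"

definition time_varying_uniform_equivalence :: "(nat \<Rightarrow> 'a::metric_space \<Rightarrow> 'a) \<Rightarrow> bool" where
  "time_varying_uniform_equivalence f \<longleftrightarrow> f 0 = id \<and> (\<forall>n. uniform_equivalence (f n))"

(* Uniform equicontinuity: delta depends neither on the point nor on the function. *)
definition equicontinuous_family :: "('a::metric_space \<Rightarrow> 'a) set \<Rightarrow> bool" where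
  "equicontinuous_family \<F> \<longleftrightarrow>
     (\<forall>\<epsilon>>0. \<exists>\<delta>>0. \<forall>x y. dist x y < \<delta> \<longrightarrow> (\<forall>g\<in>\<F>. dist (g x) (g y) < \<epsilon>))"

primrec compose_upto :: "(nat \<Rightarrow> 'a \<Rightarrow> 'a) \<Rightarrow> nat \<Rightarrow> 'a \<Rightarrow> 'a" where
  "compose_upto f 0 = f 0"
| "compose_upto f (Suc n) = f (Suc n) \<circ> compose_upto f n"

(* For n < 0 this is f_{-n}^{-1} o ... o f_1^{-1} o f_0^{-1}, which is in general
   not the inverse of the map at index -n. *)
definition tv_iterate :: "(nat \<Rightarrow> 'a \<Rightarrow> 'a) \<Rightarrow> int \<Rightarrow> 'a \<Rightarrow> 'a" where
  "tv_iterate f n =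
     (if n \<ge> 0 then compose_upto f (nat n) else compose_upto (\<lambda>i. inv (f i)) (nat (- n)))"

definition borel_measure :: "'a::topological_space measure \<Rightarrow> bool" where
  "borel_measure M \<longleftrightarrow> sets M = sets borel"

definition nonatomic :: "'a measure \<Rightarrow> bool" where
  "nonatomic M \<longleftrightarrow> (\<forall>x. emeasure M {x} = 0)"

definition outer_regular :: "'a::topological_space measure \<Rightarrow> bool" where
  "outer_regular M \<longleftrightarrow>
     (\<forall>A\<in>sets M. emeasure M A = (INF U\<in>{U. open U \<and> A \<subseteq> U}. emeasure M U))"

definition dynamic_ball :: "(nat \<Rightarrow> 'a::metric_space \<Rightarrow> 'a) \<Rightarrow> real \<Rightarrow> 'a \<Rightarrow> 'a set" where
  "dynamic_ball f \<delta> x = {y. \<forall>n. dist (tv_iterate f n x) (tv_iterate f n y) \<le> \<delta>}"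

(* emeasure is 0 on every non-measurable set; null_sets makes measurability of the dynamic
   ball explicit. For continuous iterates the ball is closed, so nothing is added. *)
definition expansive_measure :: "(nat \<Rightarrow> 'a::metric_space \<Rightarrow> 'a) \<Rightarrow> 'a measure \<Rightarrow> bool" where
  "expansive_measure f M \<longleftrightarrow> (\<exists>\<delta>>0. \<forall>x. dynamic_ball f \<delta> x \<in> null_sets M)"

definition periodic_point :: "(nat \<Rightarrow> 'a \<Rightarrow> 'a) \<Rightarrow> int \<Rightarrow> 'a \<Rightarrow> bool" where
  "periodic_point f k p \<longleftrightarrow>
     k > 0 \<and> (\<forall>i j. 0 \<le> j \<and> j < k \<longrightarrow> tv_iterate f (i * k + j) p = tv_iterate f j p)"

definition periodic_set :: "(nat \<Rightarrow> 'a \<Rightarrow> 'a) \<Rightarrow> 'a set \<Rightarrow> bool" where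
  "periodic_set f A \<longleftrightarrow> (\<exists>k>0. \<forall>p\<in>A. periodic_point f k p)"

definition aperiodic_wrt :: "(nat \<Rightarrow> 'a \<Rightarrow> 'a) \<Rightarrow> 'a measure \<Rightarrow> bool" where
  "aperiodic_wrt f M \<longleftrightarrow> (\<forall>A\<in>sets M. periodic_set f A \<longrightarrow> emeasure M A = 0)"

end

theory Submission
  imports Defs
begin

text \<open>A point of period \<^term>\<open>k\<close> visits only the values \<^term>\<open>tv_iterate f j p\<close> with
  \<^term>\<open>0 \<le> j \<and> j < k\<close>, so for two such points the closeness of all iterates is the closeness of
  finitely many. These finitely many iterates are continuous, so a set of points of period
  \<^term>\<open>k\<close> is locally contained in dynamic balls and hence locally null; in a separable space,
  locally null sets are null.\<close>

text \<open>Balls with centres in a countable dense set and radii 1/(n+1) form a countable family.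
  Those meeting \<open>A\<close> in a null set already cover \<open>A\<close>, because every ball
  around a point of \<open>A\<close> contains a smaller ball of the family around that
  point.\<close>

lemma locally_null_imp_null:
  fixes M :: "'a::metric_space measure"
  assumes sep: "separable_space (euclidean :: 'a topology)"
    and borel: "sets M = sets borel" and A: "A \<in> sets M"
    and loc: "\<And>x. x \<in> A \<Longrightarrow> \<exists>r>0. A \<inter> ball x r \<in> null_sets M"
  shows "A \<in> null_sets M"
proof -
  obtain C :: "'a set" where C: "countable C" "closure C = UNIV"
    using sep by (auto simp: separable_space_def)
  define I where
    "I = {p \<in> C \<times> (UNIV :: nat set). A \<inter> ball (fst p) (1 / Suc (snd p)) \<in> null_sets M}"
  have "countable I"
    unfolding I_def using C(1) by (intro countable_subset[OF Collect_subset]) auto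
  then have null: "(\<Union>p\<in>I. A \<inter> ball (fst p) (1 / Suc (snd p))) \<in> null_sets M"
    by (rule null_sets_UN') (simp add: I_def)
  have "A \<subseteq> (\<Union>p\<in>I. A \<inter> ball (fst p) (1 / Suc (snd p)))"
  proof
    fix x assume x: "x \<in> A"
    obtain r where r: "r > 0" "A \<inter> ball x r \<in> null_sets M"
      using loc[OF x] by blast
    \<comment> \<open>Half of \<open>r\<close> suffices: a ball of radius below r/2 whose centre is
      within r/2 of \<open>x\<close> stays inside \<open>ball x r\<close>.\<close>
    obtain n where n: "1 / real (Suc n) < r / 2"
      using reals_Archimedean[of "r / 2"] r(1) by (auto simp: inverse_eq_divide)
    obtain c where c: "c \<in> C" "dist c x < 1 / real (Suc n)"
      using C(2) closure_approachable[of x C] by (metis UNIV_I of_nat_0_less_iff zero_less_Suc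
          zero_less_divide_1_iff)
    have "ball c (1 / real (Suc n)) \<subseteq> ball x r"
    proof
      fix y assume "y \<in> ball c (1 / real (Suc n))"
      then show "y \<in> ball x r"
        using dist_triangle3[of x y c] n c(2) by simp
    qed
    then have "A \<inter> ball c (1 / real (Suc n)) \<in> null_sets M"
      by (intro null_sets_subset[OF r(2)]) (use A borel in auto)
    then have "(c, n) \<in> I"
      using c(1) by (simp add: I_def)
    then show "x \<in> (\<Union>p\<in>I. A \<inter> ball (fst p) (1 / Suc (snd p)))"
      using x c(2) by (intro UN_I[of "(c, n)"]) auto
  qed
  with null A show ?thesis
    by (rule null_sets_subset)
qed

lemma continuous_compose_upto:
  fixes f :: "nat \<Rightarrow> 'a::topological_space \<Rightarrow> 'a"
  assumes "\<And>n. continuous_on UNIV (f n)"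
  shows "continuous_on UNIV (compose_upto f n)"
proof (induction n)
  case (Suc n)
  then show ?case
    using continuous_on_compose2[OF assms[of "Suc n"]] by (simp add: comp_def)
qed (simp add: assms)

text \<open>Division with remainder. On integers, \<open>mod\<close> by a positive \<open>k\<close>
  lies in [0, k) even for negative \<open>n\<close>, so backward iterates are covered too.\<close>

lemma tv_iterate_periodic:
  assumes "periodic_point f k p"
  shows "tv_iterate f n p = tv_iterate f (n mod k) p"
proof -
  have "tv_iterate f (n div k * k + n mod k) p = tv_iterate f (n mod k) p"
    using assms unfolding periodic_point_def by (metis pos_mod_bound pos_mod_sign)
  then show ?thesis
    by simp
qed

lemma periodic_points_locally_in_dynamic_ball:
  fixes f :: "nat \<Rightarrow> 'a::metric_space \<Rightarrow> 'a"
  assumes cont: "\<And>n. continuous_on UNIV (f n)" and "\<delta> > 0" and x: "periodic_point f k x"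
  shows "\<exists>r>0. {y \<in> ball x r. periodic_point f k y} \<subseteq> dynamic_ball f \<delta> x"
proof -
  have k: "k > 0"
    using x by (simp add: periodic_point_def)
  have "eventually (\<lambda>y. dist (compose_upto f j y) (compose_upto f j x) < \<delta>) (nhds x)" for j
    using continuous_compose_upto[of f j, OF cont] \<open>\<delta> > 0\<close>
    by (metis UNIV_I continuous_on_eq_continuous_at isContD open_UNIV tendstoD tendsto_at_iff_tendsto_nhds)
  \<comment> \<open>Finitely many neighbourhoods of \<open>x\<close> intersect in a neighbourhood,
    so one radius serves all j < k.\<close>
  then have "eventually (\<lambda>y. \<forall>j\<in>{..<nat k}.
      dist (compose_upto f j y) (compose_upto f j x) < \<delta>) (nhds x)"
    by (intro eventually_ball_finite) auto
  then obtain r where r: "r > 0"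
    "\<And>y j. dist y x < r \<Longrightarrow> j < nat k \<Longrightarrow> dist (compose_upto f j y) (compose_upto f j x) < \<delta>"
    by (auto simp: eventually_nhds_metric)
  have "y \<in> dynamic_ball f \<delta> x" if y: "y \<in> ball x r" "periodic_point f k y" for y
  proof -
    have "dist (tv_iterate f n x) (tv_iterate f n y) \<le> \<delta>" for n
    proof -
      \<comment> \<open>The remainder is nonnegative, so \<open>tv_iterate\<close> unfolds to a
        forward composition, which the choice of \<open>r\<close> controls.\<close>
      have "nat (n mod k) < nat k" "n mod k \<ge> 0"
        using k by simp_all
      then have "dist (tv_iterate f (n mod k) x) (tv_iterate f (n mod k) y) \<le> \<delta>"
        using r(2)[of y "nat (n mod k)"] y(1) by (simp add: tv_iterate_def dist_commute)
      then show ?thesis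
        by (simp add: tv_iterate_periodic[OF x, of n] tv_iterate_periodic[OF y(2), of n])
    qed
    then show ?thesis
      by (simp add: dynamic_ball_def)
  qed
  then show ?thesis
    using r(1) by blast
qed

theorem corollary3p19:
  fixes f :: "nat \<Rightarrow> 'a::metric_space \<Rightarrow> 'a"
  assumes "separable_space (euclidean :: 'a topology)"
    and "time_varying_uniform_equivalence f"
    and "equicontinuous_family (range f \<union> range (\<lambda>n. inv (f n)))"
  shows "\<forall>M :: 'a measure.
           borel_measure M \<and> outer_regular M \<and> nonatomic M \<and> expansive_measure f M
             \<longrightarrow> aperiodic_wrt f M"
proof (intro allI impI)
  fix M :: "'a measure"
  assume M: "borel_measure M \<and> outer_regular M \<and> nonatomic M \<and> expansive_measure f M"
  then have borel: "sets M = sets borel"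
    by (simp add: borel_measure_def)
  obtain \<delta> where \<delta>: "\<delta> > 0" "\<And>x. dynamic_ball f \<delta> x \<in> null_sets M"
    using M by (auto simp: expansive_measure_def)
  have cont: "continuous_on UNIV (f n)" for n
    using assms(2)
    by (simp add: time_varying_uniform_equivalence_def uniform_equivalence_def
        uniformly_continuous_imp_continuous)
  show "aperiodic_wrt f M"
    unfolding aperiodic_wrt_def
  proof (intro ballI impI)
    fix A assume A: "A \<in> sets M" and "periodic_set f A"
    \<comment> \<open>One period \<open>k\<close> is shared by all of \<open>A\<close>; points near
      each other can thus be compared at the same remainders.\<close>
    then obtain k where k: "\<And>p. p \<in> A \<Longrightarrow> periodic_point f k p"
      by (auto simp: periodic_set_def)
    have "A \<in> null_sets M"
    proof (rule locally_null_imp_null[OF assms(1) borel A])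
      fix x assume "x \<in> A"
      then obtain r where r: "r > 0" "{y \<in> ball x r. periodic_point f k y} \<subseteq> dynamic_ball f \<delta> x"
        using periodic_points_locally_in_dynamic_ball[OF cont \<delta>(1) k] by blast
      \<comment> \<open>This part of \<open>A\<close> is Borel and lies in the null set
        \<open>dynamic_ball f \<delta> x\<close>.\<close>
      have "A \<inter> ball x r \<in> null_sets M"
        by (rule null_sets_subset[OF \<delta>(2)]) (use A borel r(2) k in auto)
      with r(1) show "\<exists>r>0. A \<inter> ball x r \<in> null_sets M"
        by blast
    qed
    then show "emeasure M A = 0"
      by (rule null_setsD1)
  qed
qed

end
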